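(* Let $S_n=K_{1,n-1}$ be the star graph on $n\geq2$ vertices. Then the spectrum of $M_{DS}(S_n)$ is $$\mathrm{Spec}(M_{DS}(S_n))=\left\{\pm\sqrt{n-1}\cdot\frac{\sqrt{n^2-2n+2}}{n},\ \underbrace{0,\dots,0}_{n-2\ \text{times}}\right\}$$ (as a multiset of eigenvalues).
   Context: For a finite simple graph $G$ with vertices $v_1,\dots,v_n$ and degrees $d_i=d_{v_i}$, the diminished Sombor matrix $M_{DS}(G)=(\mu_{ij})$ is the $n\times n$ real symmetric matrix with $\mu_{ij}=\frac{\sqrt{d_i^2+d_j^2}}{d_i+d_j}$ if $v_iv_j\in E(G)$, and $\mu_{ij}=0$ otherwise. *)

theory Defs
  imports "Graph_Theory.Kuratowski" "Jordan_Normal_Form.Char_Poly"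
begin

(* Finite simple graphs are instances of the locale graph: finite symmetric digraphs without
   loops and parallel arcs.  An undirected edge uv is a pair of opposite arcs, so out_degree
   is the number of neighbours of a vertex.  The list vs enumerates the vertices without
   repetition and fixes the order of the rows and columns. *)
definition diminished_Sombor_matrix :: "('a, 'b) pre_digraph \<Rightarrow> 'a list \<Rightarrow> real mat" where
  "diminished_Sombor_matrix G vs = mat (length vs) (length vs) (\<lambda>(i, j).
     let d = (\<lambda>k. real (out_degree G (vs ! k))) in
     if vs ! i \<rightarrow>\<^bsub>G\<^esub> vs ! j then sqrt ((d i)\<^sup>2 + (d j)\<^sup>2) / (d i + d j) else 0)"

(* Eigenvalues with algebraic multiplicity.  Only real roots of the characteristic polynomial
   are collected; for a real symmetric matrix these are all of them. *)
definition eigenvalue_mset :: "real mat \<Rightarrow> real multiset" where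
  "eigenvalue_mset A = proots (char_poly A)"

end

theory Submission
  imports Defs
begin

text \<open>
  The matrix of a star is \<open>a\<close> times its adjacency matrix, where \<open>a\<close> is the common weight of all
  edges. Let \<open>M\<close> be its characteristic matrix and \<open>N\<close> the identity matrix with the column of the
  centre replaced by the entry \<open>x\<close> at the centre and \<open>a\<close> elsewhere. In \<open>M N\<close> the column of the
  centre vanishes except for the diagonal entry \<open>x\<^sup>2 - (n - 1) a\<^sup>2\<close>, so expanding \<open>det (M N)\<close>
  along this column and \<open>det N\<close> along the row of the centre gives
  \<open>x det M = (x\<^sup>2 - (n - 1) a\<^sup>2) x\<^sup>n\<^sup>-\<^sup>1\<close>.
\<close>

text \<open>Laplace expansion along column \<open>c\<close> keeps one term, and the cofactor of a
  diagonal entry carries the sign (-1)^(2c) = 1.\<close>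

lemma det_single_entry_column:
  assumes A: "A \<in> carrier_mat n n" and c: "c < n"
    and z: "\<And>i. i < n \<Longrightarrow> i \<noteq> c \<Longrightarrow> A $$ (i, c) = 0"
  shows "det A = A $$ (c, c) * det (mat_delete A c c)"
proof -
  have "det A = (\<Sum>i<n. A $$ (i, c) * cofactor A i c)"
    by (rule laplace_expansion_column[OF A c])
  also have "\<dots> = (\<Sum>i<n. if i = c then A $$ (c, c) * cofactor A c c else 0)"
    by (rule sum.cong) (auto simp: z)
  finally show ?thesis
    using c by (simp add: cofactor_def)
qed

lemma det_single_entry_row:
  assumes A: "A \<in> carrier_mat n n" and c: "c < n"
    and z: "\<And>j. j < n \<Longrightarrow> j \<noteq> c \<Longrightarrow> A $$ (c, j) = 0"
  shows "det A = A $$ (c, c) * det (mat_delete A c c)"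
proof -
  have "det A = (\<Sum>j<n. A $$ (c, j) * cofactor A c j)"
    by (rule laplace_expansion_row[OF A c])
  also have "\<dots> = (\<Sum>j<n. if j = c then A $$ (c, c) * cofactor A c c else 0)"
    by (rule sum.cong) (auto simp: z)
  finally show ?thesis
    using c by (simp add: cofactor_def)
qed

text \<open>The centre sits at an arbitrary index \<open>c\<close>, since the enumeration of the
  vertices may list it anywhere.\<close>

definition star_matrix :: "nat \<Rightarrow> nat \<Rightarrow> 'a :: zero \<Rightarrow> 'a mat" where
  "star_matrix n c a = mat n n (\<lambda>(i, j). if (i = c) \<noteq> (j = c) then a else 0)"

lemma char_poly_star_matrix:
  fixes a :: "'a :: idom"
  assumes c: "c < n" and n: "n \<ge> 2"
  shows "char_poly (star_matrix n c a) = [:0, 1:] ^ (n - 2) * [:- (of_nat (n - 1) * a\<^sup>2), 0, 1:]"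
proof -
  define x :: "'a poly" where "x = [:0, 1:]"
  define M where "M = char_poly_matrix (star_matrix n c a)"
  define N where
    "N = mat n n (\<lambda>(i, j). if j = c then (if i = c then x else [:a:]) else if i = j then 1 else 0)"
  have star: "star_matrix n c a \<in> carrier_mat n n"
    by (simp add: star_matrix_def)
  have M: "M \<in> carrier_mat n n" and N: "N \<in> carrier_mat n n"
    using star by (simp_all add: M_def N_def)
  have M_nth: "M $$ (i, j) = (if i = j then x else if (i = c) \<noteq> (j = c) then [:- a:] else 0)"
    if "i < n" "j < n" for i j
    using that by (auto simp: M_def char_poly_matrix_def star_matrix_def x_def)
  have MN_nth: "(M * N) $$ (i, j) = (\<Sum>k<n. M $$ (i, k) * N $$ (k, j))" if "i < n" "j < n" for i j
    using that M N by (simp add: scalar_prod_def lessThan_atLeast0)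
  \<comment> \<open>Every column of \<open>N\<close> other than \<open>c\<close> is a unit vector,
    so multiplying by \<open>N\<close> on the right alters only column \<open>c\<close>.\<close>
  have MN_other: "(M * N) $$ (i, j) = M $$ (i, j)" if "i < n" "j < n" "j \<noteq> c" for i j
  proof -
    have "(M * N) $$ (i, j) = (\<Sum>k<n. if k = j then M $$ (i, j) else 0)"
      unfolding MN_nth[OF that(1,2)] by (rule sum.cong) (use that in \<open>auto simp: N_def\<close>)
    then show ?thesis
      using that by simp
  qed
  have MN_centre_col: "(M * N) $$ (i, c) = 0" if "i < n" "i \<noteq> c" for i
  proof -
    \<comment> \<open>Row \<open>i\<close> of \<open>M\<close> is supported on \<open>i\<close> and
      \<open>c\<close>, with entries \<open>x\<close> and \<open>-a\<close>. Column \<open>c\<close>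
      of \<open>N\<close> has \<open>a\<close> and \<open>x\<close> there, so the two products
      cancel.\<close>
    have "(M * N) $$ (i, c) = (\<Sum>k<n. (if k = i then x * [:a:] else 0) + (if k = c then [:- a:] * x else 0))"
      unfolding MN_nth[OF that(1) c] by (rule sum.cong) (use that c in \<open>auto simp: N_def M_nth\<close>)
    also have "\<dots> = 0"
      using that c by (simp add: sum.distrib)
    finally show ?thesis .
  qed
  have MN_centre: "(M * N) $$ (c, c) = [:- (of_nat (n - 1) * a\<^sup>2), 0, 1:]"
  proof -
    have "(M * N) $$ (c, c) = (\<Sum>k<n. if k = c then x * x else [:- a:] * [:a:])"
      unfolding MN_nth[OF c c] by (rule sum.cong) (use c in \<open>auto simp: N_def M_nth\<close>)
    also have "\<dots> = x * x + (\<Sum>k\<in>{..<n} - {c}. [:- a:] * [:a:])"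
      using c by (subst sum.remove[of _ c]) auto
    also have "\<dots> = x * x + of_nat (n - 1) * [:- a\<^sup>2:]"
      using c by (simp add: power2_eq_square)
    finally show ?thesis
      by (simp add: x_def of_nat_poly)
  qed
  \<comment> \<open>A star without its centre has no edges, so only the diagonal entries
    \<open>x\<close> remain.\<close>
  have "mat_delete (M * N) c c = x \<cdot>\<^sub>m 1\<^sub>m (n - 1)"
    using M N c by (intro eq_matI) (auto simp: mat_delete_def MN_other M_nth simp del: index_mult_mat(1))
  then have det_MN: "det (M * N) = [:- (of_nat (n - 1) * a\<^sup>2), 0, 1:] * x ^ (n - 1)"
    using det_single_entry_column[of "M * N" n c] M N c MN_centre_col MN_centre
    by (simp del: index_mult_mat(1))
  have "mat_delete N c c = 1\<^sub>m (n - 1)"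
    using c by (intro eq_matI) (auto simp: mat_delete_def N_def)
  then have "det N = x"
    using det_single_entry_row[OF N c] c by (simp add: N_def)
  \<comment> \<open>Splitting off one factor \<open>x\<close> prepares the cancellation of
    \<open>x\<close>, a nonzero element of the integral domain of polynomials over
    \<open>'a\<close>.\<close>
  moreover have power_n: "x ^ (n - 1) = x ^ (n - 2) * x"
    using n by (simp add: numeral_2_eq_2 Suc_diff_Suc flip: power_Suc2)
  ultimately have "det M * x = [:- (of_nat (n - 1) * a\<^sup>2), 0, 1:] * x ^ (n - 1)"
    using det_MN det_mult[OF M N] by simp
  also have "\<dots> = x ^ (n - 2) * [:- (of_nat (n - 1) * a\<^sup>2), 0, 1:] * x"
    unfolding power_n by (simp only: mult_ac)
  finally have "det M = x ^ (n - 2) * [:- (of_nat (n - 1) * a\<^sup>2), 0, 1:]"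
    by (simp add: x_def)
  then show ?thesis
    by (simp add: char_poly_def M_def x_def)
qed

text \<open>The quadratic factor splits over the reals as (X - r)(X + r) with r = sqrt(n - 1) a, and
  the power of X contributes the zeros.\<close>

lemma eigenvalue_mset_star_matrix:
  assumes c: "c < n" and n: "n \<ge> 2"
  shows "eigenvalue_mset (star_matrix n c a) =
    {# sqrt (real n - 1) * a, - (sqrt (real n - 1) * a) #} + replicate_mset (n - 2) 0"
proof -
  define r where "r = sqrt (real n - 1) * a"
  have "r * r = real (n - 1) * a\<^sup>2"
    using n by (simp add: r_def power2_eq_square of_nat_diff algebra_simps)
  then have "[:- (real (n - 1) * a\<^sup>2), 0, 1:] = [:- r, 1:] * [:r, 1:]"
    by simp
  then have "char_poly (star_matrix n c a) = [:0, 1:] ^ (n - 2) * ([:- r, 1:] * [:r, 1:])"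
    using char_poly_star_matrix[OF c n, of a] by simp
  then have "eigenvalue_mset (star_matrix n c a) =
      proots ([:0, 1:] ^ (n - 2)) + (proots [:- r, 1:] + proots [:r, 1:])"
    \<comment> \<open>The linear factors must not be multiplied out, since
      \<open>proots_mult\<close> works on the product.\<close>
    by (simp add: eigenvalue_mset_def proots_mult del: mult_pCons_left mult_pCons_right)
  then show ?thesis
    by (simp add: proots_power r_def)
qed

text \<open>Without parallel arcs, an arc leaving \<open>u\<close> is determined by its head. This
  links degrees to \<open>arcs_ends\<close>, through which complete bipartite graphs are
  described.\<close>

lemma (in nomulti_digraph) out_degree_conv_card_arcs_ends:
  "out_degree G u = card (arcs_ends G `` {u})"
proof -
  have "inj_on (head G) (out_arcs G u)"
    by (rule inj_onI) (auto intro: no_multi_arcs simp: arc_to_ends_def)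
  moreover have "head G ` out_arcs G u = arcs_ends G `` {u}"
    by (force simp: arcs_ends_conv)
  ultimately show ?thesis
    unfolding out_degree_def by (metis card_image)
qed

text \<open>Every edge joins the centre, of degree n - 1, to a leaf of degree 1, so all edges have
  the weight sqrt((n - 1)^2 + 1) / n. The index \<open>c\<close> is the position of the centre in
  \<open>vs\<close>.\<close>

lemma diminished_Sombor_matrix_star:
  fixes n :: nat and S :: "('a, 'b) pre_digraph"
  assumes n: "n \<ge> 2" and S: "K\<^bsub>1, n - 1\<^esub> S" and vs: "distinct vs" "set vs = verts S"
  obtains c where "c < n"
    "diminished_Sombor_matrix S vs = star_matrix n c (sqrt ((real n)\<^sup>2 - 2 * real n + 2) / real n)"
proof -
  from S interpret graph S
    by (simp add: complete_bipartite_digraph_def)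
  from S obtain u V where verts: "verts S = insert u V" and u: "u \<notin> V"
    and card: "card V = n - 1" and ends: "arcs_ends S = {u} \<times> V \<union> V \<times> {u}"
    unfolding complete_bipartite_digraph_def by (auto simp: card_1_singleton_iff)
  have "finite V"
    using finite_verts verts by simp
  then have len: "length vs = n"
    using vs verts u card n by (simp flip: distinct_card)
  obtain c where c: "c < n" "vs ! c = u"
    using vs verts len by (metis in_set_conv_nth insertI1)
  have eq_u: "vs ! i = u \<longleftrightarrow> i = c" if "i < n" for i
    using that c len vs(1) nth_eq_iff_index_eq by metis
  have in_V: "vs ! i \<in> V \<longleftrightarrow> i \<noteq> c" if "i < n" for i
    using that eq_u[OF that] u vs(2) verts len by (metis insertE nth_mem)
  have "arcs_ends S `` {u} = V"
    using u ends by auto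
  then have deg_u: "real (out_degree S u) = real n - 1"
    using n card by (simp add: out_degree_conv_card_arcs_ends of_nat_diff)
  have "arcs_ends S `` {v} = {u}" if "v \<in> V" for v
    using u ends that by auto
  then have deg_V: "out_degree S v = 1" if "v \<in> V" for v
    using that by (simp add: out_degree_conv_card_arcs_ends)
  have sq: "(real n - 1)\<^sup>2 + 1 = (real n)\<^sup>2 - 2 * real n + 2"
    by (simp add: power2_eq_square algebra_simps)
  have "diminished_Sombor_matrix S vs = star_matrix n c (sqrt ((real n)\<^sup>2 - 2 * real n + 2) / real n)"
  proof (rule eq_matI)
    fix i j
    assume "i < dim_row (star_matrix n c (sqrt ((real n)\<^sup>2 - 2 * real n + 2) / real n))"
      and "j < dim_col (star_matrix n c (sqrt ((real n)\<^sup>2 - 2 * real n + 2) / real n))"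
    then have ij: "i < n" "j < n"
      by (simp_all add: star_matrix_def)
    have adj: "vs ! i \<rightarrow>\<^bsub>S\<^esub> vs ! j \<longleftrightarrow> (i = c) \<noteq> (j = c)"
      using ij by (auto simp: ends eq_u in_V)
    have deg: "real (out_degree S (vs ! k)) = (if k = c then real n - 1 else 1)" if "k < n" for k
      using that c(2) in_V deg_u deg_V by auto
    show "diminished_Sombor_matrix S vs $$ (i, j) =
        star_matrix n c (sqrt ((real n)\<^sup>2 - 2 * real n + 2) / real n) $$ (i, j)"
      using ij sq by (auto simp: diminished_Sombor_matrix_def star_matrix_def len adj deg add.commute)
  qed (simp_all add: diminished_Sombor_matrix_def star_matrix_def len)
  with c(1) show ?thesis
    by (rule that)
qed

theorem corollary3p5:
  fixes n :: nat and S :: "('a, 'b) pre_digraph" and vs :: "'a list"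
  assumes "n \<ge> 2"
    and "K\<^bsub>1, n - 1\<^esub> S"
    and "distinct vs" and "set vs = verts S"
  shows "eigenvalue_mset (diminished_Sombor_matrix S vs) =
    {# sqrt (real n - 1) * (sqrt ((real n)\<^sup>2 - 2 * real n + 2) / real n),
       - (sqrt (real n - 1) * (sqrt ((real n)\<^sup>2 - 2 * real n + 2) / real n)) #}
    + replicate_mset (n - 2) 0"
  using diminished_Sombor_matrix_star[OF assms] eigenvalue_mset_star_matrix[OF _ assms(1)] by metis

end
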